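(* Let $t\in\{1,2,3\}$ and let $G$ be a simple connected $t$-tough graph of order $n$ and size $m$ (i.e., $n$ vertices and $m$ edges). If $$m \geq \binom{n-2t}{2} + 3t^2,$$ then $G$ is pancyclic or bipartite, provided that 1) $t=1$ and $n\ge 7$; or 2) $t=2$ and $n\ge 16$; or 3) $t=3$ and $n\ge 28$.
   Context: All graphs are finite, simple and undirected. For a graph $G$, $c(G)$ denotes the number of connected components of $G$. A vertex cutset of a connected graph $G$ is a set $S\subseteq V(G)$ such that $G-S$ (the subgraph induced by $V(G)\setminus S$) is disconnected, i.e. $c(G-S)\ge 2$. For a real number $t$, $G$ is called $t$-tough if $t\cdot c(G-S)\le |S|$ for every vertex cutset $S$ of $G$ (so complete graphs, having no vertex cutset, are $t$-tough for every $t$). A graph of order $n$ is pancyclic if it contains a (simple) cycle of every length $\ell$ with $3\le \ell\le n$. *)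

theory Defs
  imports Complex_Main "Graph_Theory.Graph_Theory"
begin

text \<open>
  A finite simple undirected graph is a \<^locale>\<open>pair_graph\<close>: a finite, loop-free, symmetric
  digraph without parallel arcs. The undirected edge uv is represented by the two arcs
  (u, v) and (v, u); hence edges are counted as unordered pairs.
\<close>

definition graph_order :: "'a pair_pre_digraph \<Rightarrow> nat" where
  "graph_order G = card (pverts G)"

definition graph_size :: "'a pair_pre_digraph \<Rightarrow> nat" where
  "graph_size G = card {{u, v} | u v. (u, v) \<in> parcs G}"

text \<open>
  In a symmetric digraph the strongly connected components are the connected components of
  the underlying undirected graph. The graph without vertices has no component.
\<close>

definition num_components :: "('a, 'b) pre_digraph \<Rightarrow> nat" where
  "num_components G = card (pre_digraph.sccs G)"

definition delete_verts :: "'a pair_pre_digraph \<Rightarrow> 'a set \<Rightarrow> ('a, 'a \<times> 'a) pre_digraph" where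
  "delete_verts G S = with_proj G \<restriction> (pverts G - S)"

definition vertex_cutset :: "'a pair_pre_digraph \<Rightarrow> 'a set \<Rightarrow> bool" where
  "vertex_cutset G S \<longleftrightarrow> S \<subseteq> pverts G \<and> num_components (delete_verts G S) \<ge> 2"

definition tough :: "real \<Rightarrow> 'a pair_pre_digraph \<Rightarrow> bool" where
  "tough t G \<longleftrightarrow>
    (\<forall>S. vertex_cutset G S \<longrightarrow> t * real (num_components (delete_verts G S)) \<le> real (card S))"

text \<open>
  The library's cycles are nonempty closed walks, given as lists of arcs, that repeat no vertex
  apart from the end point. They include walks u, v, u of length 2, but from length 3 on they
  are exactly the simple cycles of the undirected graph.
\<close>

definition pancyclic :: "'a pair_pre_digraph \<Rightarrow> bool" where
  "pancyclic G \<longleftrightarrow>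
    (\<forall>l. 3 \<le> l \<and> l \<le> graph_order G \<longrightarrow>
      (\<exists>p. pre_digraph.cycle (with_proj G) p \<and> length p = l))"

definition bipartite :: "'a pair_pre_digraph \<Rightarrow> bool" where
  "bipartite G \<longleftrightarrow>
    (\<exists>A B. A \<union> B = pverts G \<and> A \<inter> B = {} \<and>
      (\<forall>(u, v) \<in> parcs G. u \<in> A \<and> v \<in> B \<or> u \<in> B \<and> v \<in> A))"

end

theory Submission
  imports Defs
begin

text \<open>
  The bound forces \<open>4 m > n\<^sup>2\<close>, so by Bondy's argument a Hamiltonian cycle already yields cycles of
  all lengths, and only Hamiltonicity has to be shown (the bipartite alternative never occurs).

  Suppose it fails, and pass to an edge-maximal non-Hamiltonian supergraph, which is still
  \<open>t\<close>-tough. Let \<open>h v\<close> be the number of non-neighbours of \<open>v\<close>; by Ore's closure argument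
  \<open>h x + h y \<ge> n - 1\<close> for nonadjacent \<open>x, y\<close>. Let \<open>U\<close> be the set of universal vertices, \<open>W\<close> its
  complement, and \<open>d = h y\<close> the least value of \<open>h\<close> on \<open>W\<close>. A path cover of \<open>W\<close> by at most \<open>|U|\<close>
  paths could be closed up to a Hamiltonian cycle through \<open>U\<close>, so a minimum path cover has more
  than \<open>|U|\<close> paths. End points of different paths are nonadjacent, and toughness then gives
  \<open>(t + 1) (|U| + 1) \<le> n\<close>, and \<open>d + 4 \<le> |W|\<close> if \<open>U\<close> is nonempty. The \<open>d\<close> non-neighbours of \<open>y\<close>
  all have \<open>h \<ge> n - 1 - d\<close>; with toughness \<open>|U| < d\<close>, \<open>2 t \<le> d\<close>, and
  \<open>\<Sum>h \<ge> d (n - 1 - d) + (|W| - d) d\<close>. For \<open>d > 2 t\<close> this exceeds twice the number of missing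
  edges. For \<open>d = 2 t\<close> the count only shows that \<open>W\<close> without the
  non-neighbours of \<open>y\<close> is a clique; then deleting \<open>U\<close> separates the two parts of \<open>W\<close>, so that
  \<open>2 t \<le> |U| < d = 2 t\<close>.
\<close>

section \<open>Lists\<close>

lemma successively_drop: "successively P xs \<Longrightarrow> successively P (drop k xs)"
  by (metis append_take_drop_id successively_append_iff)

lemma successively_take: "successively P xs \<Longrightarrow> successively P (take k xs)"
  by (metis append_take_drop_id successively_append_iff)

lemma not_successively_decomp:
  assumes "\<not> successively P xs"
  shows "\<exists>as a b bs. xs = as @ a # b # bs \<and> \<not> P a b"
  using assms
proof (induction xs)
  case (Cons x xs)
  show ?case
  proof (cases "successively P xs")
    case True
    then obtain b bs where "xs = b # bs" "\<not> P x b"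
      using Cons.prems by (cases xs) auto
    then have "x # xs = [] @ x # b # bs \<and> \<not> P x b" by simp
    then show ?thesis by blast
  next
    case False
    then obtain as a b bs where "xs = as @ a # b # bs" "\<not> P a b" using Cons.IH by blast
    then have "x # xs = (x # as) @ a # b # bs \<and> \<not> P a b" by simp
    then show ?thesis by blast
  qed
qed simp

lemma path_interior_nbrs:
  assumes "x \<in> set p" "x \<noteq> hd p" "x \<noteq> last p" "distinct p" "successively P p"
  shows "\<exists>a b. a \<noteq> b \<and> a \<in> set p \<and> b \<in> set p \<and> P a x \<and> P x b"
proof -
  obtain as bs where p: "p = as @ x # bs" using split_list[OF assms(1)] by blast
  have ne: "as \<noteq> []" "bs \<noteq> []" using assms(2,3) p by auto
  then have "last as \<in> set as" "hd bs \<in> set bs" by auto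
  moreover have "P (last as) x" "P x (hd bs)"
    using assms(5) ne unfolding p by (auto simp: successively_append_iff successively_Cons)
  ultimately show ?thesis using assms(4) p by (intro exI[of _ "last as"] exI[of _ "hd bs"]) auto
qed

text \<open>Pigeonhole in \<open>I\<close>: the image of \<open>A\<close> and the set
  \<open>B\<close> are together too large to be disjoint. With \<open>f\<close> an index shift along
  a Hamiltonian path or cycle, \<open>j\<close> and \<open>f j\<close> are the far ends of the two
  chords in Ore's and Bondy's arguments.\<close>

lemma ex_common_shift:
  assumes "B \<subseteq> I" "finite I" "inj_on f A" "f ` A \<subseteq> I" "card A + card B > card I"
  shows "\<exists>j\<in>A. f j \<in> B"
proof (rule ccontr)
  assume "\<not> ?thesis"
  then have "f ` A \<inter> B = {}" by auto
  moreover have "finite (f ` A)" "finite B" using assms finite_subset by auto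
  ultimately have "card (f ` A \<union> B) = card A + card B"
    using assms(3) by (simp add: card_Un_disjoint card_image)
  moreover have "card (f ` A \<union> B) \<le> card I" using assms by (intro card_mono) auto
  ultimately show False using assms(5) by simp
qed

text \<open>Each path is entered from its own element of the first list. Spare elements follow at
  the end, whereas spare paths would be lost; hence the length condition in
  \<open>set_interleave\<close>.\<close>

fun interleave :: "'b list \<Rightarrow> 'b list list \<Rightarrow> 'b list" where
  "interleave [] ps = []"
| "interleave us [] = us"
| "interleave (u # us) (p # ps) = u # p @ interleave us ps"

lemma set_interleave:
  "length ps \<le> length us \<Longrightarrow> set (interleave us ps) = set us \<union> set (concat ps)"
  by (induction us ps rule: interleave.induct) auto

lemma length_interleave:
  "length ps \<le> length us \<Longrightarrow> length (interleave us ps) = length us + length (concat ps)"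
  by (induction us ps rule: interleave.induct) auto

lemma hd_interleave: "us \<noteq> [] \<Longrightarrow> hd (interleave us ps) = hd us"
  by (induction us ps rule: interleave.induct) auto

lemma interleave_Nil_iff: "interleave us ps = [] \<longleftrightarrow> us = []"
  by (induction us ps rule: interleave.induct) auto

section \<open>Cycles in simple graphs\<close>

locale sgraph =
  fixes V :: "'a set" and E :: "('a \<times> 'a) set"
  assumes finite_V: "finite V"
    and E_sub: "E \<subseteq> V \<times> V"
    and E_sym: "(x, y) \<in> E \<Longrightarrow> (y, x) \<in> E"
    and E_irrefl: "(x, x) \<notin> E"
begin

abbreviation adj :: "'a \<Rightarrow> 'a \<Rightarrow> bool" where
  "adj x y \<equiv> (x, y) \<in> E"

section \<open>Degrees, non-neighbours and cycles\<close>

definition deg :: "'a \<Rightarrow> nat" where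
  "deg v = card (E `` {v})"

definition conbrs :: "'a \<Rightarrow> 'a set" where
  "conbrs v = {u \<in> V. u \<noteq> v \<and> (v, u) \<notin> E}"

text \<open>The degree in the complement graph; this is the \<open>h\<close> of the
  overview.\<close>

definition codeg :: "'a \<Rightarrow> nat" where
  "codeg v = card (conbrs v)"

definition is_cycle :: "'a list \<Rightarrow> bool" where
  "is_cycle xs \<longleftrightarrow> 3 \<le> length xs \<and> distinct xs \<and> successively adj xs \<and> adj (last xs) (hd xs)"

definition hamiltonian :: bool where
  "hamiltonian \<longleftrightarrow> (\<exists>xs. is_cycle xs \<and> set xs = V)"

lemma adj_commute: "adj x y \<longleftrightarrow> adj y x"
  using E_sym by blast

lemma adjD: "adj x y \<Longrightarrow> x \<in> V \<and> y \<in> V \<and> x \<noteq> y"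
  using E_sub E_irrefl by blast

lemma finite_E: "finite E"
  using finite_subset[OF E_sub] finite_V by simp

lemma finite_nbrs [simp]: "finite (E `` {v})"
  by (rule finite_subset[OF _ finite_V]) (use E_sub in auto)

lemma conbrs_sub: "conbrs v \<subseteq> V"
  by (auto simp: conbrs_def)

lemma finite_conbrs [simp]: "finite (conbrs v)"
  using finite_subset[OF conbrs_sub finite_V] .

lemma conbrs_commute: "x \<in> V \<Longrightarrow> y \<in> conbrs x \<Longrightarrow> x \<in> conbrs y"
  by (auto simp: conbrs_def intro: E_sym)

lemma deg_codeg:
  assumes "v \<in> V" shows "deg v + codeg v + 1 = card V"
proof -
  have "V = insert v (E `` {v} \<union> conbrs v)"
    using assms E_sub by (auto simp: conbrs_def)
  then have "card V = card (insert v (E `` {v} \<union> conbrs v))" by simp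
  also have "\<dots> = Suc (card (E `` {v} \<union> conbrs v))"
    by (rule card_insert_disjoint) (simp, simp add: conbrs_def E_irrefl)
  also have "card (E `` {v} \<union> conbrs v) = deg v + codeg v"
    unfolding deg_def codeg_def by (rule card_Un_disjoint) (simp, simp, auto simp: conbrs_def)
  finally show ?thesis by simp
qed

lemma sum_deg: "(\<Sum>v\<in>V. deg v) = card E"
proof -
  have "E = (SIGMA v:V. E `` {v})" using E_sub by auto
  then have "card E = card (SIGMA v:V. E `` {v})" by simp
  also have "\<dots> = (\<Sum>v\<in>V. deg v)"
    unfolding deg_def using finite_V by (subst card_SigmaI) auto
  finally show ?thesis ..
qed

lemma card_edges: "card E = 2 * card {{u, v} | u v. (u, v) \<in> E}"
proof -
  let ?f = "\<lambda>(u, v). {u, v}"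
  have im: "?f ` E = {{u, v} | u v. (u, v) \<in> E}" by auto
  have "card E = (\<Sum>e \<in> ?f ` E. card {p \<in> E. ?f p = e})"
    using sum.image_gen[OF finite_E, of "\<lambda>_. 1::nat" ?f] by simp
  also have "\<dots> = (\<Sum>e \<in> ?f ` E. 2)"
  proof (rule sum.cong)
    fix e assume "e \<in> ?f ` E"
    then obtain a b where e: "(a, b) \<in> E" "e = {a, b}" by auto
    then have "{p \<in> E. ?f p = e} = {(a, b), (b, a)}"
      using E_sym by (auto simp: doubleton_eq_iff)
    then show "card {p \<in> E. ?f p = e} = 2" using adjD[OF e(1)] by simp
  qed simp
  finally show ?thesis by (simp add: im)
qed

lemma successively_adj_rev: "successively adj (rev xs) \<longleftrightarrow> successively adj xs"
  by (simp add: adj_commute)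

lemma is_cycle_rotate: "is_cycle (xs @ ys) \<Longrightarrow> is_cycle (ys @ xs)"
  by (cases "xs = []"; cases "ys = []") (auto simp: is_cycle_def successively_append_iff)

section \<open>Crossing chords: Ore's lemma and Bondy's cycles of all lengths\<close>

lemma card_nbr_indices:
  assumes "distinct xs" "set xs = V"
  shows "card {i. i < length xs \<and> adj v (xs ! i)} = deg v"
proof -
  have "bij_betw (\<lambda>i. xs ! i) {i. i < length xs \<and> adj v (xs ! i)} (E `` {v})"
    unfolding bij_betw_def
  proof
    show "inj_on ((!) xs) {i. i < length xs \<and> adj v (xs ! i)}"
      using assms(1) by (auto simp: inj_on_def nth_eq_iff_index_eq)
    show "(!) xs ` {i. i < length xs \<and> adj v (xs ! i)} = E `` {v}"
      using assms(2) E_sub by (force simp: in_set_conv_nth)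
  qed
  then show ?thesis unfolding deg_def by (rule bij_betw_same_card)
qed

text \<open>Follow the path from its head to \<open>xs ! k\<close>, jump to its last vertex, run
  back to \<open>xs ! j\<close> and return to the head. Only the vertices strictly between
  \<open>k\<close> and \<open>j\<close> are skipped, so \<open>k = j - 1\<close> yields a
  Hamiltonian cycle.\<close>

lemma path_crossing_cycle:
  assumes xs: "distinct xs" "successively adj xs"
    and jk: "0 < j" "k < j" "j < length xs" "3 \<le> Suc k + (length xs - j)"
    and e: "adj (hd xs) (xs ! j)" "adj (last xs) (xs ! k)"
  shows "is_cycle (take (Suc k) xs @ rev (drop j xs))"
proof -
  have ne: "xs \<noteq> []" "drop j xs \<noteq> []" "take (Suc k) xs \<noteq> []" using jk by auto
  have l: "last (take (Suc k) xs) = xs ! k" using jk by (simp add: take_Suc_conv_app_nth)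
  have h: "hd (take (Suc k) xs) = hd xs" using ne by (cases xs) auto
  have "set (take (Suc k) xs) \<inter> set (drop j xs) = {}"
    using xs(1) jk by (simp add: set_take_disj_set_drop_if_distinct)
  moreover have "hd (drop j xs) = xs ! j" using jk by (simp add: hd_drop_conv_nth)
  moreover have "last (drop j xs) = last xs" using jk by simp
  moreover have "successively adj (rev (drop j xs))"
    using xs(2) by (simp only: successively_adj_rev successively_drop)
  ultimately show ?thesis
    using xs jk ne e l h
    by (auto simp: is_cycle_def successively_append_iff hd_rev last_rev successively_take
        intro: E_sym simp del: successively_rev)
qed

text \<open>The predecessors of the head's neighbours and the neighbours of the last vertex lie
  among the first \<open>?n - 1\<close> indices and number at least \<open>?n\<close> together. A
  common index gives chords to \<open>j\<close> and \<open>j - 1\<close> that close a Hamiltonian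
  cycle.\<close>

lemma ore_path:
  assumes xs: "distinct xs" "set xs = V" "successively adj xs" "3 \<le> length xs"
    and d: "card V \<le> deg (hd xs) + deg (last xs)"
  shows hamiltonian
proof -
  let ?n = "length xs"
  have n: "card V = ?n" using xs distinct_card by metis
  have ne: "xs \<noteq> []" using xs(4) by auto
  define A where "A = {i. i < ?n \<and> adj (hd xs) (xs ! i)}"
  define B where "B = {i. i < ?n \<and> adj (last xs) (xs ! i)}"
  have A: "card A = deg (hd xs)" "card B = deg (last xs)"
    using card_nbr_indices[OF xs(1,2)] by (auto simp: A_def B_def)
  have A0: "0 \<notin> A" using ne E_irrefl by (simp add: A_def hd_conv_nth)
  have Bl: "?n - 1 \<notin> B" using ne E_irrefl by (simp add: B_def last_conv_nth)
  have Apos: "0 < i" if "i \<in> A" for i using that A0 by (cases i) auto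
  have "\<exists>j\<in>A. j - 1 \<in> B"
  proof (rule ex_common_shift[of _ "{..<?n - 1}"])
    show "B \<subseteq> {..<?n - 1}"
    proof
      fix i assume "i \<in> B"
      moreover from this have "i \<noteq> ?n - 1" using Bl by blast
      ultimately show "i \<in> {..<?n - 1}" by (auto simp: B_def)
    qed
    \<comment> \<open>Truncated subtraction would identify the images of 0 and 1; 0 is not in
      \<open>A\<close> because the graph has no loops.\<close>
    show "inj_on (\<lambda>j. j - 1) A"
      by (rule inj_on_diff_nat) (use Apos in \<open>auto simp: Suc_le_eq\<close>)
    show "(\<lambda>j. j - 1) ` A \<subseteq> {..<?n - 1}"
      using Apos by (fastforce simp: A_def)
  qed (use A d n xs(4) in simp_all)
  then obtain j where j: "j \<in> A" "j - 1 \<in> B" by blast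
  then have "0 < j" "j < ?n" using Apos by (auto simp: A_def)
  with j xs have "is_cycle (take (Suc (j - 1)) xs @ rev (drop j xs))"
    by (intro path_crossing_cycle) (auto simp: A_def B_def)
  moreover have "set (take (Suc (j - 1)) xs @ rev (drop j xs)) = V"
    using \<open>0 < j\<close> xs(2) by (metis Suc_pred' append_take_drop_id set_append set_rev)
  ultimately show ?thesis unfolding hamiltonian_def by blast
qed

lemma cycle_of_length:
  assumes xs: "is_cycle xs" "set xs = V"
    and d: "card V < deg (hd xs) + deg (last xs)"
    and l: "3 \<le> l" "l \<le> card V"
  shows "\<exists>ys. is_cycle ys \<and> length ys = l"
proof -
  let ?n = "length xs"
  have xs': "distinct xs" "successively adj xs" "adj (last xs) (hd xs)" "3 \<le> ?n"
    using xs by (auto simp: is_cycle_def)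
  have n: "card V = ?n" using xs xs' distinct_card by metis
  have ne: "xs \<noteq> []" using xs'(4) by auto
  define A where "A = {i. i < ?n \<and> adj (hd xs) (xs ! i)}"
  define B where "B = {i. i < ?n \<and> adj (last xs) (xs ! i)}"
  have fin: "finite A" "finite B" by (auto simp: A_def B_def)
  have A: "card A = deg (hd xs)" "card B = deg (last xs)"
    using card_nbr_indices[OF xs'(1) xs(2)] by (auto simp: A_def B_def)
  have mem: "0 \<notin> A" "?n - 1 \<notin> B" "?n - 1 \<in> A" "0 \<in> B"
    using ne E_irrefl xs'(3) E_sym[OF xs'(3)] by (auto simp: A_def B_def hd_conv_nth last_conv_nth)
  \<comment> \<open>The closing edge counts in both degrees. Without it at least
    \<open>?n - 1\<close> chords remain for the \<open>?n - 2\<close> inner indices, enough for the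
    pigeonhole.\<close>
  define A' where "A' = A - {?n - 1}"
  define B' where "B' = B - {0}"
  have card': "card A' + 1 = card A" "card B' + 1 = card B"
    using mem fin card_Suc_Diff1[of A "?n - 1"] card_Suc_Diff1[of B 0] by (auto simp: A'_def B'_def)
  have A'sub: "A' \<subseteq> {1..<?n - 1}"
  proof
    fix i assume "i \<in> A'"
    then have "i \<in> A" "i \<noteq> ?n - 1" by (auto simp: A'_def)
    moreover from this have "i \<noteq> 0" using mem by metis
    ultimately have "i \<noteq> ?n - 1" "i \<noteq> 0" "i < ?n" by (auto simp: A_def)
    then show "i \<in> {1..<?n - 1}" by auto
  qed
  have B'sub: "B' \<subseteq> {1..<?n - 1}"
  proof
    fix i assume "i \<in> B'"
    then have "i \<in> B" "i \<noteq> 0" by (auto simp: B'_def)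
    moreover from this have "i \<noteq> ?n - 1" using mem by metis
    ultimately have "i \<noteq> ?n - 1" "i \<noteq> 0" "i < ?n" by (auto simp: B_def)
    then show "i \<in> {1..<?n - 1}" by auto
  qed
  \<comment> \<open>Shifting the indices \<open>1..n-2\<close> cyclically by \<open>l - 3\<close> pairs each chord at the first vertex
    with the chord at the last vertex that closes a cycle of length \<open>l\<close>.\<close>
  let ?f = "\<lambda>j. if j + (l - 3) < ?n - 1 then j + (l - 3) else j + l - 1 - ?n"
  have "\<exists>j\<in>A'. ?f j \<in> B'"
  proof (rule ex_common_shift[OF B'sub])
    show "inj_on ?f A'"
    proof (rule inj_onI)
      fix x y assume "x \<in> A'" "y \<in> A'" and eq: "?f x = ?f y"
      then have "1 \<le> x" "x < ?n - 1" "1 \<le> y" "y < ?n - 1" using A'sub by auto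
      with eq l n show "x = y" by (simp split: if_splits)
    qed
    show "?f ` A' \<subseteq> {1..<?n - 1}"
    proof (rule image_subsetI)
      fix x assume "x \<in> A'"
      then have "1 \<le> x" "x < ?n - 1" using A'sub by auto
      with l n show "?f x \<in> {1..<?n - 1}" by auto
    qed
  qed (use card' A d n xs'(4) in simp_all)
  then obtain j where j: "j \<in> A'" "?f j \<in> B'" by blast
  have j': "1 \<le> j" "j < ?n - 1" "adj (hd xs) (xs ! j)"
    using j A'sub by (auto simp: A'_def A_def)
  show ?thesis
  proof (cases "j + (l - 3) < ?n - 1")
    case True
    \<comment> \<open>The two chords lead to the ends of a segment of \<open>l - 2\<close> vertices,
      which the first and last vertex of \<open>xs\<close> complete to a cycle through the closing
      edge.\<close>
    define ys where "ys = take (l - 2) (drop j xs)"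
    have "adj (last xs) (xs ! (j + (l - 3)))" using j(2) True by (simp add: B'_def B_def)
    moreover have ylen: "length ys = l - 2" using True l by (simp add: ys_def)
    moreover have "last ys = xs ! (j + (l - 3))"
      using ylen l True by (subst last_conv_nth) (auto simp: ys_def numeral_eq_Suc Suc_diff_Suc)
    moreover have "hd ys = xs ! j"
      using ylen l True by (subst hd_conv_nth) (auto simp: ys_def)
    moreover have "hd xs \<notin> set ys" "last xs \<notin> set ys"
      using xs'(1) ne j' True l
      by (auto simp: ys_def in_set_conv_nth hd_conv_nth last_conv_nth nth_eq_iff_index_eq)
    moreover have "distinct ys" "successively adj ys"
      using xs' by (auto simp: ys_def successively_drop successively_take)
    moreover have "hd xs \<noteq> last xs" using xs'(3) E_irrefl by metis
    moreover have "ys \<noteq> []" using ylen l by auto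
    ultimately have "is_cycle (hd xs # ys @ [last xs])" "length (hd xs # ys @ [last xs]) = l"
      using xs'(3) j'(3) l by (auto simp: is_cycle_def successively_append_iff successively_Cons intro: E_sym)
    then show ?thesis by blast
  next
    case False
    \<comment> \<open>Here the shift has wrapped around by \<open>?n - 2\<close>. The prefix of
      \<open>Suc k\<close> vertices and the suffix of \<open>?n - j\<close> vertices now have
      \<open>l\<close> vertices together.\<close>
    define k where "k = j + l - 1 - ?n"
    have k: "k < j" "j < ?n" "Suc k + (?n - j) = l" "adj (last xs) (xs ! k)"
      using False j j' l n by (auto simp: B'_def B_def k_def)
    have "is_cycle (take (Suc k) xs @ rev (drop j xs))"
      by (rule path_crossing_cycle) (use xs' j' k l in auto)
    moreover have "length (take (Suc k) xs @ rev (drop j xs)) = l" using k by simp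
    ultimately show ?thesis by blast
  qed
qed

text \<open>Averaging: the degree sums of the edges of the cycle add up to twice the total degree,
  that is to \<open>2 * card E\<close>, so they cannot all be at most \<open>card V\<close>. A
  rotation makes the heavy edge the closing one.\<close>

lemma cycle_heavy_edge:
  assumes "is_cycle xs" "set xs = V" "card V ^ 2 < 2 * card E"
  shows "\<exists>ys. is_cycle ys \<and> set ys = V \<and> card V < deg (hd ys) + deg (last ys)"
proof (rule ccontr)
  assume contr: "\<not> ?thesis"
  have light: "deg (hd ys) + deg (last ys) \<le> card V" if "is_cycle ys" "set ys = V" for ys
    using contr that not_le by blast
  let ?n = "length xs"
  have xs: "distinct xs" "3 \<le> ?n" using assms(1) by (auto simp: is_cycle_def)
  have n: "card V = ?n" using assms xs distinct_card by metis
  have ne: "xs \<noteq> []" using xs by auto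
  have step: "deg (xs ! i) + deg (xs ! Suc i) \<le> ?n" if "i < ?n - 1" for i
  proof -
    have "is_cycle (drop (Suc i) xs @ take (Suc i) xs)"
      using is_cycle_rotate[of "take (Suc i) xs" "drop (Suc i) xs"] assms(1) by simp
    moreover have "set (drop (Suc i) xs @ take (Suc i) xs) = V"
      using assms(2) by (metis append_take_drop_id set_append sup_commute)
    ultimately have "deg (hd (drop (Suc i) xs @ take (Suc i) xs))
        + deg (last (drop (Suc i) xs @ take (Suc i) xs)) \<le> card V" by (rule light)
    moreover have "hd (drop (Suc i) xs @ take (Suc i) xs) = xs ! Suc i"
      using that by (auto simp: hd_append hd_drop_conv_nth)
    moreover have "last (drop (Suc i) xs @ take (Suc i) xs) = xs ! i"
      using that by (simp add: take_Suc_conv_app_nth)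
    ultimately show ?thesis using n by simp
  qed
  have wrap: "deg (xs ! 0) + deg (xs ! (?n - 1)) \<le> ?n"
    using light[OF assms(1,2)] ne n by (simp add: hd_conv_nth last_conv_nth)
  have "(\<Sum>v\<in>V. deg v) = (\<Sum>i<?n. deg (xs ! i))"
    using sum.reindex_bij_betw[OF bij_betw_nth[OF xs(1) refl refl], of deg] assms(2) by simp
  moreover obtain m where m: "?n = Suc m" using ne by (cases ?n) auto
  ultimately have "2 * card E = (\<Sum>i<Suc m. deg (xs ! i)) + (\<Sum>i<Suc m. deg (xs ! i))"
    using sum_deg by simp
  also have "\<dots> = (\<Sum>i<m. deg (xs ! i) + deg (xs ! Suc i)) + (deg (xs ! 0) + deg (xs ! m))"
    by (subst (2) sum.lessThan_Suc_shift) (simp add: sum.distrib)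
  also have "\<dots> \<le> (\<Sum>i<m. ?n) + ?n"
    using step wrap m by (intro add_mono sum_mono) auto
  also have "\<dots> = card V ^ 2" using m n by (simp add: power2_eq_square)
  finally show False using assms(3) by simp
qed

lemma hamiltonian_imp_all_cycles:
  assumes hamiltonian "card V ^ 2 < 2 * card E" "3 \<le> l" "l \<le> card V"
  shows "\<exists>ys. is_cycle ys \<and> length ys = l"
proof -
  obtain xs where "is_cycle xs" "set xs = V" using assms(1) unfolding hamiltonian_def by blast
  from cycle_heavy_edge[OF this assms(2)] obtain ys
    where "is_cycle ys" "set ys = V" "card V < deg (hd ys) + deg (last ys)" by blast
  from cycle_of_length[OF this assms(3,4)] show ?thesis .
qed

section \<open>Closure and edge-maximal non-Hamiltonian graphs\<close>

lemma sgraph_insert_edge: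
  assumes "x \<in> V" "y \<in> V" "x \<noteq> y"
  shows "sgraph V (insert (x, y) (insert (y, x) E))"
  using assms finite_V E_sub E_sym E_irrefl by unfold_locales auto

text \<open>A Hamiltonian cycle that uses the new edge is rotated until this edge closes it. What
  remains is a Hamiltonian path of the old graph from one of \<open>x\<close>, \<open>y\<close> to
  the other, to which \<open>ore_path\<close> applies.\<close>

lemma ore_closure:
  assumes xy: "x \<in> V" "y \<in> V" "x \<noteq> y" and d: "card V \<le> deg x + deg y"
    and ham: "sgraph.hamiltonian V (insert (x, y) (insert (y, x) E))"
  shows hamiltonian
proof (rule ccontr)
  assume non: "\<not> hamiltonian"
  let ?F = "insert (x, y) (insert (y, x) E)"
  interpret F: sgraph V ?F using xy by (rule sgraph_insert_edge)
  obtain xs where xs: "F.is_cycle xs" "set xs = V" using ham unfolding F.hamiltonian_def by blast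
  have "\<exists>ys. F.is_cycle ys \<and> set ys = V \<and> \<not> adj (last ys) (hd ys)"
  proof (cases "successively adj xs")
    case True
    then show ?thesis using xs non by (auto simp: hamiltonian_def is_cycle_def F.is_cycle_def)
  next
    case False
    then obtain as a b bs where *: "xs = as @ a # b # bs" "\<not> adj a b"
      using not_successively_decomp by blast
    then have "F.is_cycle ((b # bs) @ (as @ [a]))"
      using xs(1) by (simp add: F.is_cycle_rotate[of "as @ [a]" "b # bs", simplified])
    moreover have "set ((b # bs) @ (as @ [a])) = V" using * xs(2) by auto
    moreover have "\<not> adj (last ((b # bs) @ (as @ [a]))) (hd ((b # bs) @ (as @ [a])))"
      using * by simp
    ultimately show ?thesis by blast
  qed
  then obtain ys where ys: "F.is_cycle ys" "set ys = V" "\<not> adj (last ys) (hd ys)" by blast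
  then have ends: "{last ys, hd ys} = {x, y}" by (auto simp: F.is_cycle_def)
  have ys': "distinct ys" "3 \<le> length ys" using ys by (auto simp: F.is_cycle_def)
  \<comment> \<open>A second missing edge would again have the ends \<open>x\<close> and
    \<open>y\<close>, hence join the head and the last vertex as neighbours in the list. The list
    would then have length 2.\<close>
  have "successively adj ys"
  proof (rule ccontr)
    assume "\<not> ?thesis"
    then obtain as c d bs where *: "ys = as @ c # d # bs" "\<not> adj c d"
      using not_successively_decomp by blast
    then have "(c, d) \<in> ?F" using ys(1) by (auto simp: F.is_cycle_def successively_append_iff)
    then have cd: "{c, d} = {last ys, hd ys}" using *(2) ends by auto
    have "hd ys \<noteq> d" using * ys'(1) by (cases as) auto
    then have "hd ys = c" "last ys = d" using cd by (auto simp: doubleton_eq_iff)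
    have "as = []"
      using \<open>hd ys = c\<close> ys'(1) unfolding *(1) by (cases as) auto
    moreover have "bs = []"
      using \<open>last ys = d\<close> ys'(1) last_in_set[of bs] unfolding *(1) by (auto split: if_splits)
    ultimately show False using * ys'(2) by simp
  qed
  moreover have "card V \<le> deg (hd ys) + deg (last ys)"
    using d ends by (auto simp: doubleton_eq_iff)
  ultimately have hamiltonian using ore_path ys(2) ys' by blast
  then show False using non by blast
qed

lemma ex_edge_maximal:
  assumes "\<not> hamiltonian"
  shows "\<exists>F. E \<subseteq> F \<and> sgraph V F \<and> \<not> sgraph.hamiltonian V F \<and>
    (\<forall>x\<in>V. \<forall>y\<in>V. x \<noteq> y \<and> (x, y) \<notin> F \<longrightarrow>
      sgraph.hamiltonian V (insert (x, y) (insert (y, x) F)))"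
proof -
  let ?A = "{F. E \<subseteq> F \<and> sgraph V F \<and> \<not> sgraph.hamiltonian V F}"
  have "?A \<subseteq> Pow (V \<times> V)" by (auto dest: sgraph.E_sub)
  then have "finite ?A" using finite_V finite_subset by (metis finite_Pow_iff finite_SigmaI)
  moreover have "E \<in> ?A" using assms sgraph_axioms by auto
  ultimately have "\<exists>F\<in>?A. E \<subseteq> F \<and> (\<forall>G\<in>?A. F \<subseteq> G \<longrightarrow> F = G)"
    by (rule finite_has_maximal2)
  then obtain F where F: "F \<in> ?A" "\<forall>G\<in>?A. F \<subseteq> G \<longrightarrow> F = G"
    by (elim bexE conjE) (rule that)
  then interpret F: sgraph V F by simp
  have "sgraph.hamiltonian V (insert (x, y) (insert (y, x) F))"
    if "x \<in> V" "y \<in> V" "x \<noteq> y" "(x, y) \<notin> F" for x y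
  proof (rule ccontr)
    assume "\<not> ?thesis"
    then have "insert (x, y) (insert (y, x) F) \<in> ?A"
      using F(1) F.sgraph_insert_edge[OF that(1-3)] by auto
    then have "F = insert (x, y) (insert (y, x) F)" by (rule F(2)[rule_format]) blast
    then show False using that(4) by (metis insertI1)
  qed
  then show ?thesis using F(1) by blast
qed

section \<open>Path covers and universal vertices\<close>

definition path_cover :: "'a set \<Rightarrow> 'a list set \<Rightarrow> bool" where
  "path_cover W P \<longleftrightarrow> finite P \<and> (\<forall>p\<in>P. p \<noteq> [] \<and> distinct p \<and> successively adj p) \<and>
    (\<forall>p\<in>P. \<forall>q\<in>P. p \<noteq> q \<longrightarrow> set p \<inter> set q = {}) \<and> (\<Union>p\<in>P. set p) = W"

lemma ex_min_path_cover:
  assumes "finite W"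
  shows "\<exists>P. path_cover W P \<and> (\<forall>Q. path_cover W Q \<longrightarrow> card P \<le> card Q)"
proof -
  have "path_cover W ((\<lambda>v. [v]) ` W)" using assms by (auto simp: path_cover_def)
  from ex_has_least_nat[of "path_cover W", OF this, of card] show ?thesis by blast
qed

text \<open>After reversing where necessary, \<open>a\<close> ends the first path and
  \<open>b\<close> starts the second, and the two are concatenated. Thus in a minimum cover the ends
  of different paths are nonadjacent.\<close>

lemma merge_paths:
  assumes P: "path_cover W P" and pq: "p \<in> P" "q \<in> P" "p \<noteq> q"
    and ab: "a \<in> {hd p, last p}" "b \<in> {hd q, last q}" "adj a b"
  shows "\<exists>Q. path_cover W Q \<and> card Q < card P"
proof -
  have p: "p \<noteq> []" "distinct p" "successively adj p" "q \<noteq> []" "distinct q" "successively adj q"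
    and disj: "\<And>r s. r \<in> P \<Longrightarrow> s \<in> P \<Longrightarrow> r \<noteq> s \<Longrightarrow> set r \<inter> set s = {}"
    and W: "(\<Union>p\<in>P. set p) = W" and fin: "finite P"
    using P pq by (auto simp: path_cover_def)
  define p' where "p' = (if last p = a then p else rev p)"
  define q' where "q' = (if hd q = b then q else rev q)"
  have p': "set p' = set p" "distinct p'" "successively adj p'" "last p' = a" "p' \<noteq> []"
    using p ab(1) by (auto simp: p'_def last_rev successively_adj_rev simp del: successively_rev)
  have q': "set q' = set q" "distinct q'" "successively adj q'" "hd q' = b" "q' \<noteq> []"
    using p ab(2) by (auto simp: q'_def hd_rev successively_adj_rev simp del: successively_rev)
  let ?r = "p' @ q'"
  let ?Q = "insert ?r (P - {p, q})"
  have r: "?r \<noteq> []" "distinct ?r" "successively adj ?r" "set ?r = set p \<union> set q"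
    using p' q' ab(3) disj[OF pq] by (auto simp: successively_append_iff)
  have r_disj: "set ?r \<inter> set s = {}" if "s \<in> P - {p, q}" for s
    using disj[of s p] disj[of s q] that pq unfolding r(4) by auto
  have "path_cover W ?Q"
    unfolding path_cover_def
  proof (intro conjI ballI impI)
    show "finite ?Q" using fin by simp
    show "(\<Union>p\<in>?Q. set p) = W" using W pq r(4) by auto
    show "s \<noteq> []" "distinct s" "successively adj s" if "s \<in> ?Q" for s
      using that r P unfolding path_cover_def by blast+
    show "set s \<inter> set s' = {}" if "s \<in> ?Q" "s' \<in> ?Q" "s \<noteq> s'" for s s'
      using that r_disj[of s] r_disj[of s'] disj[of s s'] by (metis Diff_iff Int_commute insert_iff)
  qed
  moreover have "card ?Q < card P"
  proof -
    have "card (P - {p, q}) + 2 = card P"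
      using pq fin card_Diff_subset[of "{p, q}" P] card_mono[of P "{p, q}"] by simp
    then show ?thesis using card_insert_if[of "P - {p, q}" ?r] fin by auto
  qed
  ultimately show ?thesis by blast
qed

lemma successively_universal:
  assumes "distinct us" "set us \<subseteq> V" "\<And>u v. u \<in> set us \<Longrightarrow> v \<in> V \<Longrightarrow> u \<noteq> v \<Longrightarrow> adj u v"
  shows "successively adj us"
  using assms by (induction us rule: induct_list012) auto

lemma successively_interleave:
  assumes "length ps \<le> length us" "distinct us" "set us \<subseteq> V"
    and "\<And>u v. u \<in> set us \<Longrightarrow> v \<in> V \<Longrightarrow> u \<noteq> v \<Longrightarrow> adj u v"
    and "\<And>p. p \<in> set ps \<Longrightarrow> p \<noteq> [] \<and> successively adj p \<and> set p \<subseteq> V - set us"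
  shows "successively adj (interleave us ps)"
  using assms
proof (induction us ps rule: interleave.induct)
  case (2 u us)
  then show ?case using successively_universal[of "u # us"] by simp
next
  case (3 u us p ps)
  have IH: "successively adj (interleave us ps)"
    by (rule "3.IH") (use "3.prems" in auto)
  have p: "p \<noteq> []" "successively adj p" "set p \<subseteq> V - set (u # us)" using "3.prems"(5) by auto
  have ends: "hd p \<in> V - set (u # us)" "last p \<in> V - set (u # us)"
    using p(1,3) hd_in_set last_in_set by blast+
  then have "adj u (hd p)" by (intro "3.prems"(4)) auto
  moreover have "adj (last p) (hd us)" if "us \<noteq> []"
  proof (rule E_sym, rule "3.prems"(4))
    show "hd us \<in> set (u # us)" using that by simp
    then show "hd us \<noteq> last p" using ends(2) by force
  qed (use ends in blast)
  ultimately show ?case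
    using IH p
    by (cases "us = []")
      (auto simp: successively_append_iff successively_Cons hd_interleave interleave_Nil_iff)
qed simp

text \<open>Each path is preceded by its own universal vertex, so every junction of the interleaved
  list, including the closing one, involves a universal vertex and is an edge.\<close>

lemma hamiltonian_if_few_paths:
  assumes U: "U \<subseteq> V" "\<And>u v. u \<in> U \<Longrightarrow> v \<in> V \<Longrightarrow> u \<noteq> v \<Longrightarrow> adj u v"
    and P: "path_cover (V - U) P" "card P \<le> card U" and n: "3 \<le> card V"
  shows hamiltonian
proof -
  have fU: "finite U" using U(1) finite_V finite_subset by blast
  obtain us where us: "set us = U" "distinct us" using finite_distinct_list[OF fU] by blast
  obtain ps where ps: "set ps = P" "distinct ps"
    using finite_distinct_list[of P] P(1) by (auto simp: path_cover_def)
  have len: "length ps \<le> length us" using P(2) us ps by (metis distinct_card)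
  have dc: "distinct (concat ps)" and sc: "set (concat ps) = V - U"
    using P(1) ps by (auto simp: path_cover_def intro!: distinct_concat)
  have ne: "us \<noteq> []"
  proof
    assume "us = []"
    then have "V = {}" using len us sc by auto
    then show False using n by simp
  qed
  let ?L = "interleave us ps"
  have set: "set ?L = V" using set_interleave[OF len] sc us U(1) by auto
  have "length ?L = card V"
    using length_interleave[OF len] distinct_card[OF us(2)] distinct_card[OF dc] us(1) sc
      card_Diff_subset[OF fU U(1)] card_mono[OF finite_V U(1)] by simp
  then have dL: "distinct ?L" using set by (simp add: card_distinct)
  have "successively adj ?L"
    by (rule successively_interleave[OF len us(2)])
      (use U us P ps in \<open>auto simp: path_cover_def\<close>)
  moreover have "adj (last ?L) (hd ?L)"
  proof (rule E_sym, rule U(2))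
    show "hd ?L \<in> U" using ne us by (auto simp: hd_interleave)
    show "last ?L \<in> V" using set ne by (metis interleave_Nil_iff last_in_set)
    show "hd ?L \<noteq> last ?L"
      using dL \<open>length ?L = card V\<close> n by (cases ?L) auto
  qed
  ultimately have "is_cycle ?L"
    using dL \<open>length ?L = card V\<close> n by (simp add: is_cycle_def)
  then show ?thesis using set unfolding hamiltonian_def by blast
qed

end

section \<open>Closed tough graphs\<close>

text \<open>
  Toughness without components: any labelling that is constant along the edges outside \<open>S\<close> uses
  at most as many labels as there are components, which makes monotonicity in \<open>E\<close> immediate.
\<close>

definition label_tough :: "nat \<Rightarrow> 'a set \<Rightarrow> ('a \<times> 'a) set \<Rightarrow> bool" where
  "label_tough t V E \<longleftrightarrow>
    (\<forall>S (f :: 'a \<Rightarrow> 'a). S \<subseteq> V \<longrightarrow>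
      (\<forall>x\<in>V - S. \<forall>y\<in>V - S. (x, y) \<in> E \<longrightarrow> f x = f y) \<longrightarrow>
      2 \<le> card (f ` (V - S)) \<longrightarrow> t * card (f ` (V - S)) \<le> card S)"

lemma label_toughD:
  fixes f :: "'a \<Rightarrow> 'a"
  assumes "label_tough t V E" "S \<subseteq> V"
    and "\<And>x y. x \<in> V - S \<Longrightarrow> y \<in> V - S \<Longrightarrow> (x, y) \<in> E \<Longrightarrow> f x = f y"
    and "2 \<le> card (f ` (V - S))"
  shows "t * card (f ` (V - S)) \<le> card S"
  using assms(1)[unfolded label_tough_def, rule_format, of S f] assms(2-) by simp

lemma label_tough_mono:
  assumes "label_tough t V E" "E \<subseteq> F"
  shows "label_tough t V F"
  unfolding label_tough_def
proof (intro allI impI)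
  fix S and f :: "'a \<Rightarrow> 'a"
  assume "S \<subseteq> V" "\<forall>x\<in>V - S. \<forall>y\<in>V - S. (x, y) \<in> F \<longrightarrow> f x = f y" "2 \<le> card (f ` (V - S))"
  then show "t * card (f ` (V - S)) \<le> card S"
    using assms(2) by (intro label_toughD[OF assms(1)]) auto
qed

text \<open>The arithmetic of the case \<open>d > 2 t\<close>: \<open>n\<close>, \<open>w\<close>,
  \<open>u\<close> are the sizes of \<open>V\<close>, \<open>W\<close>, \<open>U\<close>,
  \<open>d\<close> is the least codegree on \<open>W\<close>, and \<open>s\<close> is the sum of all
  codegrees, which the edge bound limits.\<close>

lemma codeg_count_contradiction:
  fixes n w u d s t :: int
  assumes t: "t = 1 \<and> 7 \<le> n \<or> t = 2 \<and> 16 \<le> n \<or> t = 3 \<and> 28 \<le> n"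
    and w: "u + w = n" "0 \<le> u" "u < d" and d: "2 * t < d"
    and uni: "(t + 1) * (u + 1) \<le> n"
    and sparse: "0 < u \<Longrightarrow> d + 4 \<le> w"
    and s1: "d * (n - 1 - d) + (w - d) * d \<le> s" and s2: "w * d \<le> s"
    and s: "s + 10 * t ^ 2 + 2 * t \<le> 4 * t * n"
  shows False
proof -
  consider "t = 1" "7 \<le> n" | "t = 2" "16 \<le> n" | "t = 3" "28 \<le> n" using t by blast
  then show False
  proof cases
    case 1
    show False
    proof (cases "d = 3")
      case True
      \<comment> \<open>For \<open>u = 0\<close> the bounds give \<open>2 * n \<le> 9\<close>.
        Otherwise \<open>u \<le> 2\<close> gives \<open>2 * w \<le> 11\<close>, against
        \<open>7 \<le> w\<close> from \<open>sparse\<close>.\<close>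
      then show False using 1 w s1 s sparse by auto
    next
      case False
      then have d4: "4 \<le> d" using d 1 by simp
      show False
      proof (cases "u = 0")
        case True
        have "n * 4 \<le> n * d" using d4 1 by (intro mult_left_mono) auto
        also have "\<dots> \<le> s" using s2 True w by simp
        finally show False using s 1 by simp
      next
        case False
        then have "d + 4 \<le> w" using sparse w by simp
        then have "4 * d \<le> (w - d) * d" using d4 by (intro mult_right_mono) auto
        moreover have "0 \<le> (d - 4) * (n - 1 - d)"
          using d4 w \<open>d + 4 \<le> w\<close> by (intro mult_nonneg_nonneg) auto
        ultimately show False using s1 s 1 by (simp add: algebra_simps)
      qed
    qed
  next
    case 2
    have w3: "2 * n + 3 \<le> 3 * w" using uni w 2 by simp
    show False
    proof (cases "d = 5")
      case True
      \<comment> \<open>With \<open>u \<le> 4\<close> this comes down to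
        \<open>2 * n \<le> 31\<close>, which \<open>16 \<le> n\<close> just excludes.\<close>
      then show False using 2 w s1 s by auto
    next
      case False
      then have d6: "6 \<le> d" using d 2 by simp
      have dw: "(2 * n + 3) * d \<le> 3 * w * d" using w3 d6 by (intro mult_right_mono) auto
      show False
      proof (cases "2 * d < n")
        case True
        \<comment> \<open>By \<open>dw\<close>, three times the left side of \<open>s1\<close> is at
          least \<open>5 * n * d - 6 * d ^ 2\<close>. Subtracting the value of this at
          \<open>d = 6\<close> leaves the product of \<open>d - 6\<close> and
          \<open>5 * n - 6 * d - 36\<close>.\<close>
        then have "6 * d + 36 \<le> 5 * n" using 2 by presburger
        then have "0 \<le> (d - 6) * (5 * n - 6 * d - 36)" using d6 by (intro mult_nonneg_nonneg) auto
        then show False using s1 s dw 2 by (simp add: algebra_simps power2_eq_square)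
      next
        case False
        then have "(2 * n + 3) * n \<le> (2 * n + 3) * (2 * d)" using 2 by (intro mult_left_mono) auto
        \<comment> \<open>\<open>2 n\<^sup>2 - 45 n + 264\<close> has negative discriminant; likewise \<open>3 n\<^sup>2 - 92 n + 768\<close> below.\<close>
        moreover have "0 \<le> (4 * n - 45) ^ 2" by simp
        ultimately show False using s2 s dw 2 by (simp add: algebra_simps power2_eq_square)
      qed
    qed
  next
    case 3
    have w4: "3 * n + 4 \<le> 4 * w" using uni w 3 by simp
    have d7: "7 \<le> d" using d 3 by simp
    have dw: "(3 * n + 4) * d \<le> 4 * w * d" using w4 d7 by (intro mult_right_mono) auto
    show False
    proof (cases "2 * d < n")
      case True
      \<comment> \<open>Likewise with \<open>7 * n * d - 8 * d ^ 2\<close>, a lower bound for four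
        times the left side of \<open>s1\<close>, and its value at \<open>d = 7\<close>.\<close>
      then have "0 \<le> (d - 7) * (7 * n - 8 * d - 56)"
        using d7 3 by (intro mult_nonneg_nonneg) auto
      then show False using s1 s dw 3 by (simp add: algebra_simps power2_eq_square)
    next
      case False
      then have "(3 * n + 4) * n \<le> (3 * n + 4) * (2 * d)" using 3 by (intro mult_left_mono) auto
      moreover have "0 \<le> (3 * n - 46) ^ 2" by simp
      ultimately show False using s2 s dw 3 by (simp add: algebra_simps power2_eq_square)
    qed
  qed
qed

text \<open>The situation after passing to an edge-maximal supergraph. By \<open>deg_codeg\<close>,
  \<open>ore\<close> says that nonadjacent vertices have degree sum less than
  \<open>card V\<close>.\<close>

locale closed_tough = sgraph +
  fixes t :: nat
  assumes tough: "label_tough t V E"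
    and t_pos: "1 \<le> t"
    and nonham: "\<not> hamiltonian"
    and order_ge: "3 \<le> card V"
    and ore: "x \<in> V \<Longrightarrow> y \<in> conbrs x \<Longrightarrow> card V \<le> codeg x + codeg y + 1"
begin

section \<open>Universal vertices, a minimum path cover and consequences of toughness\<close>

definition W :: "'a set" where "W = {v \<in> V. conbrs v \<noteq> {}}"

definition U :: "'a set" where "U = V - W"

lemma W_sub: "W \<subseteq> V" by (auto simp: W_def)

lemma U_sub: "U \<subseteq> V" by (auto simp: U_def)

lemma finite_W: "finite W" using finite_subset[OF W_sub finite_V] .

lemma finite_U: "finite U" using finite_subset[OF U_sub finite_V] .

lemma V_minus_U: "V - U = W" using W_sub by (auto simp: U_def)

lemma card_U_W: "card U + card W = card V"
  using card_Diff_subset[OF finite_W W_sub] card_mono[OF finite_V W_sub] by (simp add: U_def)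

lemma universal: "u \<in> U \<Longrightarrow> v \<in> V \<Longrightarrow> u \<noteq> v \<Longrightarrow> adj u v"
  by (auto simp: U_def W_def conbrs_def)

lemma conbrs_W: "x \<in> V \<Longrightarrow> conbrs x \<subseteq> W"
  using conbrs_commute conbrs_sub unfolding W_def by blast

lemma codeg_eq_0_iff: "codeg v = 0 \<longleftrightarrow> conbrs v = {}"
  by (simp add: codeg_def)

lemma codeg_U: "u \<in> U \<Longrightarrow> codeg u = 0"
  by (auto simp: U_def W_def codeg_eq_0_iff)

lemma codeg_less: "x \<in> W \<Longrightarrow> codeg x < card W"
  using conbrs_W W_sub unfolding codeg_def
  by (intro psubset_card_mono finite_W) (auto simp: conbrs_def)

lemma path_cover_gt: "path_cover W P \<Longrightarrow> card U < card P"
  using hamiltonian_if_few_paths[OF U_sub universal, of P] nonham order_ge V_minus_U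
  by (cases "card P \<le> card U") auto

lemma W_nonempty: "W \<noteq> {}"
proof
  assume "W = {}"
  then have "path_cover W {}" by (simp add: path_cover_def)
  then show False using path_cover_gt by fastforce
qed

definition cover :: "'a list set" where
  "cover = (SOME P. path_cover W P \<and> (\<forall>Q. path_cover W Q \<longrightarrow> card P \<le> card Q))"

lemma path_cover_cover: "path_cover W cover"
  and cover_min: "path_cover W Q \<Longrightarrow> card cover \<le> card Q"
  using someI_ex[OF ex_min_path_cover[OF finite_W], folded cover_def] by simp_all

lemma cover_paths:
  assumes "p \<in> cover"
  shows "p \<noteq> []" "distinct p" "successively adj p" "set p \<subseteq> W"
  using assms path_cover_cover by (auto simp: path_cover_def)

lemma cover_disjoint: "p \<in> cover \<Longrightarrow> q \<in> cover \<Longrightarrow> v \<in> set p \<Longrightarrow> v \<in> set q \<Longrightarrow> p = q"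
  using path_cover_cover by (auto simp: path_cover_def)

lemma ends_not_adj:
  assumes "p \<in> cover" "q \<in> cover" "p \<noteq> q" "a \<in> {hd p, last p}" "b \<in> {hd q, last q}"
  shows "\<not> adj a b"
proof
  assume "adj a b"
  then obtain Q where "path_cover W Q" "card Q < card cover"
    using merge_paths[OF path_cover_cover assms] by blast
  then show False using cover_min[of Q] by simp
qed

lemma card_hd_cover: "card (hd ` cover) = card cover"
proof (rule card_image, rule inj_onI)
  fix p q assume pq: "p \<in> cover" "q \<in> cover" "hd p = hd q"
  then have "hd p \<in> set p" "hd p \<in> set q" using cover_paths(1) hd_in_set by metis+
  then show "p = q" using pq cover_disjoint by blast
qed

lemma hd_cover_W: "hd ` cover \<subseteq> W"
  using cover_paths hd_in_set by blast

text \<open>The heads of the paths in a minimum cover form an independent set of more than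
  \<open>card U\<close> vertices. Deleting all other vertices leaves them as singletons, to which
  toughness applies.\<close>

lemma universal_bound:
  assumes "t + 1 \<le> card V"
  shows "(t + 1) * (card U + 1) \<le> card V"
\<comment> \<open>For empty \<open>U\<close> the cover may be a single path; its head alone gives no
  cutset, and the claim is the assumption.\<close>
proof (cases "card U = 0")
  case False
  let ?I = "hd ` cover"
  have k: "card U < card cover" using path_cover_gt[OF path_cover_cover] .
  have sub: "?I \<subseteq> V" using hd_cover_W W_sub by blast
  then have I: "V - (V - ?I) = ?I" by blast
  have "t * card (id ` (V - (V - ?I))) \<le> card (V - ?I)"
  proof (rule label_toughD[OF tough])
    fix x y assume "x \<in> V - (V - ?I)" "y \<in> V - (V - ?I)" "adj x y"
    then show "id x = id y" using ends_not_adj unfolding I by auto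
  qed (use k False card_hd_cover in \<open>auto simp: I\<close>)
  also have "card (V - ?I) = card V - card cover"
    using card_Diff_subset[OF finite_subset[OF sub finite_V] sub] card_hd_cover by simp
  finally have "t * card cover \<le> card V - card cover" using card_hd_cover I by simp
  moreover have "card cover \<le> card V"
    using card_mono[OF finite_V sub] card_hd_cover by simp
  ultimately have "(t + 1) * card cover \<le> card V" by simp
  moreover have "(t + 1) * (card U + 1) \<le> (t + 1) * card cover" using k by (intro mult_le_mono2) simp
  ultimately show ?thesis by simp
qed (use assms in simp)

text \<open>If it failed, deleting \<open>U\<close> would leave the paths of the cover without edges
  between them. With \<open>U\<close> nonempty there are at least two, and more than
  \<open>card U\<close>, against toughness.\<close>

lemma ex_sparse_codeg:
  assumes "U \<noteq> {}"
  shows "\<exists>x\<in>W. codeg x + 4 \<le> card W"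
proof (rule ccontr)
  assume contr: "\<not> ?thesis"
  have "\<forall>v\<in>W. \<exists>p. p \<in> cover \<and> v \<in> set p"
    using path_cover_cover by (auto simp: path_cover_def)
  then obtain g where g: "\<And>v. v \<in> W \<Longrightarrow> g v \<in> cover \<and> v \<in> set (g v)" by metis
  \<comment> \<open>Otherwise \<open>W\<close> induces a graph of maximum degree 2, whose components are exactly the paths of the cover.\<close>
  have end_if: "x \<in> {hd (g x), last (g x)}"
    if xy: "x \<in> W" "y \<in> W" "adj x y" "g x \<noteq> g y" for x y
  proof (rule ccontr)
    assume "x \<notin> {hd (g x), last (g x)}"
    then obtain a b where ab: "a \<noteq> b" "a \<in> set (g x)" "b \<in> set (g x)" "adj a x" "adj x b"
      using path_interior_nbrs[of x "g x" adj] g[OF xy(1)] cover_paths(2,3)[of "g x"] by auto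
    have "y \<notin> set (g x)" using g xy cover_disjoint by metis
    then have "y \<noteq> a" "y \<noteq> b" using ab by auto
    moreover have "a \<in> W" "b \<in> W" using ab g[OF xy(1)] cover_paths(4)[of "g x"] by auto
    ultimately have card4: "card {x, y, a, b} = 4" and sub4: "{x, y, a, b} \<subseteq> W"
      using ab xy adjD[OF xy(3)] adjD[OF ab(4)] adjD[OF ab(5)] by auto
    \<comment> \<open>The vertex \<open>x\<close> itself, its two neighbours on the path and the
      neighbour \<open>y\<close> off the path account for the constant 4.\<close>
    have "conbrs x \<subseteq> W - {x, y, a, b}"
      using conbrs_W[of x] xy(1,3) ab(5) E_sym[OF ab(4)] W_sub by (auto simp: conbrs_def)
    then have "codeg x \<le> card (W - {x, y, a, b})"
      unfolding codeg_def using finite_W by (intro card_mono) auto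
    also have "\<dots> = card W - 4"
      using card4 sub4 card_Diff_subset[of "{x, y, a, b}" W] by simp
    finally have "codeg x \<le> card W - 4" .
    moreover have "4 \<le> card W" using card_mono[OF finite_W sub4] card4 by simp
    ultimately show False using contr xy(1) by auto
  qed
  have img: "(hd \<circ> g) ` W = hd ` cover"
  proof
    show "hd ` cover \<subseteq> (hd \<circ> g) ` W"
    proof
      fix v assume "v \<in> hd ` cover"
      then obtain p where p: "p \<in> cover" "v = hd p" by blast
      then have "v \<in> set p" "v \<in> W" using cover_paths[of p] by auto
      then have "g v = p" using g p(1) cover_disjoint by metis
      then show "v \<in> (hd \<circ> g) ` W" using \<open>v \<in> W\<close> p(2) by force
    qed
  qed (use g in auto)
  have k: "card U < card cover" "0 < card U"
    using path_cover_gt[OF path_cover_cover] assms finite_U by (auto simp: card_gt_0_iff)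
  have "t * card ((hd \<circ> g) ` (V - U)) \<le> card U"
  proof (rule label_toughD[OF tough U_sub])
    fix x y assume xy: "x \<in> V - U" "y \<in> V - U" "adj x y"
    then have xy': "x \<in> W" "y \<in> W" "adj y x" using V_minus_U E_sym by auto
    show "(hd \<circ> g) x = (hd \<circ> g) y"
    proof (rule ccontr)
      assume "\<not> ?thesis"
      then have "g x \<noteq> g y" by auto
      then have "x \<in> {hd (g x), last (g x)}" "y \<in> {hd (g y), last (g y)}"
        using end_if[of x y] end_if[of y x] xy(3) xy' by auto
      with \<open>g x \<noteq> g y\<close> show False
        using ends_not_adj[of "g x" "g y" x y] g xy(3) xy' by simp
    qed
  qed (use k img card_hd_cover V_minus_U in simp)
  then have "t * card cover \<le> card U" using img card_hd_cover V_minus_U by simp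
  moreover have "card cover \<le> t * card cover" using t_pos by simp
  ultimately show False using k by simp
qed

text \<open>Deleting the neighbours of \<open>x\<close> separates \<open>x\<close> from its
  non-neighbours, so there are at least two components.\<close>

lemma min_deg:
  assumes "x \<in> W" shows "2 * t \<le> deg x"
proof -
  obtain y where y: "y \<in> conbrs x" using assms by (auto simp: W_def)
  have x: "x \<in> V" using assms W_sub by blast
  have V: "V - E `` {x} = insert x (conbrs x)"
    using x by (auto simp: conbrs_def E_irrefl)
  let ?f = "\<lambda>z. if z = x then x else y"
  have img: "?f ` (V - E `` {x}) = {x, y}" "x \<noteq> y"
    unfolding V using y by (auto simp: conbrs_def)
  have "t * card (?f ` (V - E `` {x})) \<le> card (E `` {x})"
  proof (rule label_toughD[OF tough])
    fix a b assume "a \<in> V - E `` {x}" "b \<in> V - E `` {x}" "adj a b"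
    then show "?f a = ?f b" unfolding V by (auto simp: conbrs_def dest: E_sym)
  qed (use E_sub img in auto)
  then show ?thesis using img by (simp add: deg_def)
qed

text \<open>Otherwise \<open>ore\<close> makes every non-neighbour of \<open>y\<close> isolated once
  \<open>U\<close> is deleted. Together with the part of \<open>y\<close> this gives at least
  \<open>codeg y + 1\<close> components, so toughness forces \<open>codeg y < card U\<close>; but
  \<open>ore\<close> also forces \<open>card U \<le> codeg y\<close>.\<close>

lemma universal_less_codeg:
  assumes y: "y \<in> W"
  shows "card U < codeg y"
proof (rule ccontr)
  assume "\<not> ?thesis"
  then have le: "codeg y \<le> card U" by simp
  have yV: "y \<in> V" and yX: "y \<notin> conbrs y" using y W_sub by (auto simp: conbrs_def)
  have full: "conbrs x = W - {x}" if x: "x \<in> conbrs y" for x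
  proof (rule card_subset_eq)
    have xW: "x \<in> W" using x conbrs_W[OF yV] by blast
    then show sub: "conbrs x \<subseteq> W - {x}" using conbrs_W[of x] W_sub by (auto simp: conbrs_def)
    show fin: "finite (W - {x})" using finite_W by simp
    have "card W \<le> codeg x + 1" using ore[OF yV x] le card_U_W by simp
    then have "card (W - {x}) \<le> card (conbrs x)" using xW finite_W by (simp add: codeg_def)
    then show "card (conbrs x) = card (W - {x})" using card_mono[OF fin sub] by simp
  qed
  let ?f = "\<lambda>z. if z \<in> conbrs y then z else y"
  have img: "?f ` (V - U) = insert y (conbrs y)"
    unfolding V_minus_U using y yX conbrs_W[OF yV] by auto
  have card: "card (insert y (conbrs y)) = Suc (codeg y)" using yX by (simp add: codeg_def)
  have pos: "0 < codeg y" using y by (simp add: W_def codeg_def card_gt_0_iff)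
  have "t * card (?f ` (V - U)) \<le> card U"
  proof (rule label_toughD[OF tough U_sub])
    fix a b assume "a \<in> V - U" "b \<in> V - U" and ab: "adj a b"
    then have "a \<in> W" "b \<in> W" "a \<noteq> b" using V_minus_U adjD by auto
    then have "a \<notin> conbrs y" "b \<notin> conbrs y"
      using full[of a] full[of b] ab E_sym[OF ab] by (auto simp: conbrs_def)
    then show "?f a = ?f b" by simp
  qed (use img card pos in simp)
  then have "t * Suc (codeg y) \<le> card U" using img card by simp
  moreover have "1 * Suc (codeg y) \<le> t * Suc (codeg y)" using t_pos by (rule mult_le_mono1)
  moreover have "card U \<le> codeg y"
  proof -
    obtain x where x: "x \<in> conbrs y" using y by (auto simp: W_def)
    then have "x \<in> W" using conbrs_W[OF yV] by blast
    then have "codeg x + 1 = card W"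
      using full[OF x] card_Suc_Diff1[OF finite_W, of x] by (simp add: codeg_def)
    then show ?thesis using ore[OF yV x] card_U_W by simp
  qed
  ultimately show False by simp
qed

text \<open>In the clique, the non-neighbours of any vertex lie in \<open>conbrs y\<close>, and by
  minimality they fill it. So no edge joins the clique to \<open>conbrs y\<close>, and deleting
  \<open>U\<close> separates the two.\<close>

lemma codeg_clique_complement:
  assumes y: "y \<in> W" and min: "\<And>x. x \<in> W \<Longrightarrow> codeg y \<le> codeg x"
    and clique: "\<And>a b. a \<in> W - conbrs y \<Longrightarrow> b \<in> W - conbrs y \<Longrightarrow> a \<noteq> b \<Longrightarrow> adj a b"
  shows "2 * t \<le> card U"
proof -
  have yV: "y \<in> V" and yX: "y \<notin> conbrs y" using y W_sub by (auto simp: conbrs_def)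
  obtain x where x: "x \<in> conbrs y" using y by (auto simp: W_def)
  have eq: "conbrs z = conbrs y" if z: "z \<in> W - conbrs y" for z
  proof (rule card_subset_eq)
    show sub: "conbrs z \<subseteq> conbrs y"
    proof
      fix a assume a: "a \<in> conbrs z"
      then have "a \<in> W" "a \<noteq> z" "\<not> adj z a" using conbrs_W[of z] z W_sub by (auto simp: conbrs_def)
      then show "a \<in> conbrs y" using clique[OF z, of a] by blast
    qed
    show "card (conbrs z) = card (conbrs y)"
      using min[of z] z card_mono[OF finite_conbrs sub] by (simp add: codeg_def)
  qed simp
  let ?f = "\<lambda>z. if z \<in> conbrs y then x else y"
  have img: "?f ` (V - U) = {x, y}" "x \<noteq> y"
    unfolding V_minus_U using y x yX conbrs_W[OF yV] by auto
  have "t * card (?f ` (V - U)) \<le> card U"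
  proof (rule label_toughD[OF tough U_sub])
    fix a b assume "a \<in> V - U" "b \<in> V - U" and ab: "adj a b"
    then have W: "a \<in> W" "b \<in> W" using V_minus_U by auto
    have "a \<in> conbrs y \<longleftrightarrow> b \<in> conbrs y"
      using eq[of a] eq[of b] W ab E_sym[OF ab] by (auto simp: conbrs_def)
    then show "?f a = ?f b" by simp
  qed (use img in simp)
  then show ?thesis using img by simp
qed

section \<open>Counting missing edges\<close>

lemma sum_codeg_W: "(\<Sum>v\<in>V. codeg v) = (\<Sum>v\<in>W. codeg v)"
  using codeg_U by (intro sum.mono_neutral_right finite_V W_sub) (simp add: U_def)

text \<open>By \<open>ore\<close> each non-neighbour of \<open>y\<close> has codegree at least
  \<open>card V - 1 - codeg y\<close>; the other vertices of \<open>W\<close> have at least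
  \<open>codeg y\<close>. In the third bound a nonadjacent pair among the latter contributes
  \<open>card V - 1\<close> in place of \<open>2 * codeg y\<close>.\<close>

lemma sum_codeg_ge:
  assumes y: "y \<in> W" and min: "\<And>x. x \<in> W \<Longrightarrow> codeg y \<le> codeg x"
  shows "codeg y * (card V - 1 - codeg y) + (card W - codeg y) * codeg y \<le> (\<Sum>v\<in>V. codeg v)"
    and "card W * codeg y \<le> (\<Sum>v\<in>V. codeg v)"
    and "\<lbrakk>a \<in> W - conbrs y; b \<in> W - conbrs y; a \<noteq> b; \<not> adj a b\<rbrakk> \<Longrightarrow>
      codeg y * (card V - 1 - codeg y) + (card V - 1) + (card W - codeg y - 2) * codeg y
        \<le> (\<Sum>v\<in>V. codeg v)"
proof -
  let ?X = "conbrs y"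
  have yV: "y \<in> V" using y W_sub by blast
  have X: "?X \<subseteq> W" using conbrs_W[OF yV] .
  have sumX: "codeg y * (card V - 1 - codeg y) \<le> (\<Sum>v\<in>?X. codeg v)"
  proof -
    have "of_nat (card ?X) * (card V - 1 - codeg y) \<le> (\<Sum>v\<in>?X. codeg v)"
      by (rule sum_bounded_below) (use ore[OF yV] in fastforce)
    then show ?thesis by (simp add: codeg_def)
  qed
  have sum_ge: "card A * codeg y \<le> (\<Sum>v\<in>A. codeg v)" if "A \<subseteq> W" for A
    using sum_bounded_below[of A "codeg y" codeg] min that by auto
  have split: "(\<Sum>v\<in>V. codeg v) = (\<Sum>v\<in>?X. codeg v) + (\<Sum>v\<in>W - ?X. codeg v)"
    unfolding sum_codeg_W using sum.subset_diff[OF X finite_W, of codeg] by simp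
  have card: "card (W - ?X) = card W - codeg y"
    using card_Diff_subset[OF finite_conbrs X] by (simp add: codeg_def)
  show "codeg y * (card V - 1 - codeg y) + (card W - codeg y) * codeg y \<le> (\<Sum>v\<in>V. codeg v)"
    using sumX sum_ge[of "W - ?X"] unfolding split card by (intro add_mono) auto
  show "card W * codeg y \<le> (\<Sum>v\<in>V. codeg v)"
    using sum_ge[of W] by (simp add: sum_codeg_W)
  assume ab: "a \<in> W - ?X" "b \<in> W - ?X" "a \<noteq> b" "\<not> adj a b"
  then have "b \<in> conbrs a" "a \<in> V" using W_sub by (auto simp: conbrs_def)
  then have "card V - 1 \<le> codeg a + codeg b" using ore[of a b] by simp
  moreover have "(\<Sum>v\<in>W - ?X. codeg v) = codeg a + codeg b + (\<Sum>v\<in>W - ?X - {a, b}. codeg v)"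
    using sum.subset_diff[of "{a, b}" "W - ?X" codeg] ab finite_W by simp
  moreover have "card (W - ?X - {a, b}) = card W - codeg y - 2"
    using card_Diff_subset[of "{a, b}" "W - ?X"] ab card by simp
  then have "(card W - codeg y - 2) * codeg y \<le> (\<Sum>v\<in>W - ?X - {a, b}. codeg v)"
    using sum_ge[of "W - ?X - {a, b}"] by auto
  ultimately show "codeg y * (card V - 1 - codeg y) + (card V - 1) + (card W - codeg y - 2) * codeg y
      \<le> (\<Sum>v\<in>V. codeg v)"
    using sumX unfolding split by linarith
qed

lemma too_dense:
  assumes t: "t = 1 \<and> 7 \<le> card V \<or> t = 2 \<and> 16 \<le> card V \<or> t = 3 \<and> 28 \<le> card V"
    and s: "(\<Sum>v\<in>V. codeg v) + 10 * t ^ 2 + 2 * t \<le> 4 * t * card V"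
  shows False
proof -
  obtain y where y: "y \<in> W" and min: "\<And>x. x \<in> W \<Longrightarrow> codeg y \<le> codeg x"
    using ex_min_if_finite[OF finite_imageI[OF finite_W, of codeg]] W_nonempty
    by (metis (no_types, lifting) image_iff image_is_empty linorder_not_less)
  have yV: "y \<in> V" using y W_sub by blast
  obtain x where x: "x \<in> conbrs y" using y by (auto simp: W_def)
  have xW: "x \<in> W" using x conbrs_W[OF yV] by blast
  \<comment> \<open>The minimum degree bound is applied to the non-neighbour \<open>x\<close>: its
    codegree is at most \<open>card V - 1 - 2 * t\<close>, and \<open>ore\<close> transfers the gap
    to \<open>y\<close>.\<close>
  have d2t: "2 * t \<le> codeg y"
    using min_deg[OF xW] deg_codeg[of x] xW W_sub ore[OF yV x] by auto
  have u: "card U < codeg y" using universal_less_codeg[OF y] .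
  have dn: "codeg y < card W" using codeg_less[OF y] .
  show False
  proof (cases "codeg y = 2 * t")
    case True
    have "adj a b" if "a \<in> W - conbrs y" "b \<in> W - conbrs y" "a \<noteq> b" for a b
    proof (rule ccontr)
      assume "\<not> adj a b"
      \<comment> \<open>This keeps the subtraction in the third bound from truncating.\<close>
      moreover have "codeg y + 2 \<le> card W"
        using card_mono[of W "insert a (insert b (conbrs y))"] that conbrs_W[OF yV] finite_W
        by (simp add: codeg_def)
      \<comment> \<open>With \<open>card U \<le> 2 * t - 1\<close> the third bound would give
        \<open>card V \<le> 2 * t ^ 2 + 2 * t + 1\<close>, that is 5, 13 or 25.\<close>
      ultimately show False
        using sum_codeg_ge(3)[OF y min that] t s u card_U_W unfolding True by auto
    qed
    then have "2 * t \<le> card U" using codeg_clique_complement[OF y min] by blast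
    then show False using u True by simp
  next
    case False
    show False
    proof (rule codeg_count_contradiction)
      show "int t = 1 \<and> 7 \<le> int (card V) \<or> int t = 2 \<and> 16 \<le> int (card V) \<or>
        int t = 3 \<and> 28 \<le> int (card V)" using t by auto
      show "int (card U) + int (card W) = int (card V)" using card_U_W by simp
      show "(int t + 1) * (int (card U) + 1) \<le> int (card V)"
        using universal_bound t by (simp flip: of_nat_Suc of_nat_mult add: algebra_simps) auto
      show "int (codeg y) + 4 \<le> int (card W)" if "0 < int (card U)"
        using ex_sparse_codeg that min by fastforce
      show "int (codeg y) * (int (card V) - 1 - int (codeg y))
          + (int (card W) - int (codeg y)) * int (codeg y) \<le> int (\<Sum>v\<in>V. codeg v)"
      proof -
        have "int (card V) - 1 - int (codeg y) = int (card V - 1 - codeg y)"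
          "int (card W) - int (codeg y) = int (card W - codeg y)"
          using dn card_U_W by auto
        then show ?thesis
          using sum_codeg_ge(1)[OF y min]
          by (simp only: of_nat_mult[symmetric] of_nat_add[symmetric] of_nat_le_iff)
      qed
      show "int (card W) * int (codeg y) \<le> int (\<Sum>v\<in>V. codeg v)"
        using sum_codeg_ge(2)[OF y min] by (simp only: of_nat_mult[symmetric] of_nat_le_iff)
      have "int ((\<Sum>v\<in>V. codeg v) + 10 * t ^ 2 + 2 * t) \<le> int (4 * t * card V)"
        using s by (simp only: of_nat_le_iff)
      then show "int (\<Sum>v\<in>V. codeg v) + 10 * int t ^ 2 + 2 * int t \<le> 4 * int t * int (card V)"
        by (simp only: of_nat_mult of_nat_add of_nat_power of_nat_numeral)
    qed (use u d2t False in auto)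
  qed
qed

end

section \<open>The theorem\<close>

lemma (in sgraph) sum_codeg: "(\<Sum>v\<in>V. codeg v) + card E + card V = card V * card V"
proof -
  have "(\<Sum>v\<in>V. deg v + codeg v + 1) = (\<Sum>v\<in>V. card V)"
    by (intro sum.cong refl deg_codeg)
  then show ?thesis using sum_deg by (simp only: sum.distrib) simp
qed

lemma (in sgraph) hamiltonian_if_tough_dense:
  assumes tough: "label_tough t V E"
    and t: "t = 1 \<and> 7 \<le> card V \<or> t = 2 \<and> 16 \<le> card V \<or> t = 3 \<and> 28 \<le> card V"
    and s: "(\<Sum>v\<in>V. codeg v) + 10 * t ^ 2 + 2 * t \<le> 4 * t * card V"
  shows hamiltonian
proof (rule ccontr)
  assume "\<not> hamiltonian"
  then obtain F where F: "E \<subseteq> F" "sgraph V F" "\<not> sgraph.hamiltonian V F"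
    and max: "\<forall>x\<in>V. \<forall>y\<in>V. x \<noteq> y \<and> (x, y) \<notin> F \<longrightarrow>
      sgraph.hamiltonian V (insert (x, y) (insert (y, x) F))"
    using ex_edge_maximal by blast
  interpret F: sgraph V F by fact
  interpret F: closed_tough V F t
  proof
    show "label_tough t V F" using tough F(1) by (rule label_tough_mono)
    show "\<not> F.hamiltonian" by fact
    show "1 \<le> t" "3 \<le> card V" using t by auto
    fix x y assume x: "x \<in> V" and "y \<in> F.conbrs x"
    then have y: "y \<in> V" "x \<noteq> y" "(x, y) \<notin> F" by (auto simp: F.conbrs_def)
    have "\<not> card V \<le> F.deg x + F.deg y"
      using F.ore_closure[OF x y(1,2)] max x y F(3) by blast
    then show "card V \<le> F.codeg x + F.codeg y + 1"
      using F.deg_codeg[OF x] F.deg_codeg[OF y(1)] by linarith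
  qed
  \<comment> \<open>Added edges only lower the codegree sum, so the density bound passes to
    \<open>F\<close>.\<close>
  have "card E \<le> card F" using F(1) F.finite_E by (rule card_mono[rotated])
  then have "(\<Sum>v\<in>V. F.codeg v) \<le> (\<Sum>v\<in>V. codeg v)"
    using sum_codeg F.sum_codeg by linarith
  then show False using F.too_dense[OF t] s by linarith
qed

section \<open>Translation to and from the graph library\<close>

lemma cas_closed_walk: "pcas x (zip (x # xs) (xs @ [y])) y"
  by (induction xs arbitrary: x) auto

lemma set_closed_walk:
  "successively (\<lambda>a b. (a, b) \<in> E) (x # xs) \<Longrightarrow> (last (x # xs), y) \<in> E \<Longrightarrow>
    set (zip (x # xs) (xs @ [y])) \<subseteq> E"
  by (induction xs arbitrary: x) auto

context pair_graph
begin

lemma sgraph: "sgraph (pverts G) (parcs G)"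
proof
  show "(x, x) \<notin> parcs G" for x using no_loops'[of x x] by blast
qed (use pair_finite_verts wellformed' arcs_symmetric in auto)

lemma cycle_if_is_cycle:
  assumes "sgraph.is_cycle (parcs G) xs"
  shows "\<exists>p. cycle p \<and> length p = length xs"
proof -
  interpret S: sgraph "pverts G" "parcs G" by (rule sgraph)
  obtain x ys where xs: "xs = x # ys" using assms by (cases xs) (auto simp: S.is_cycle_def)
  \<comment> \<open>Each vertex is paired with its cyclic successor, which turns the vertex list
    into the arc list of a closed walk.\<close>
  let ?p = "zip (x # ys) (ys @ [x])"
  have cas: "pcas x ?p x" by (rule cas_closed_walk)
  have "set ?p \<subseteq> parcs G"
    by (rule set_closed_walk) (use assms in \<open>auto simp: S.is_cycle_def xs\<close>)
  moreover have "x \<in> pverts G" using assms S.adjD by (auto simp: S.is_cycle_def xs)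
  ultimately have "awalk x ?p x" using cas by (auto simp: awalk_def)
  moreover have "pawalk_verts x ?p = fst (hd ?p) # map snd ?p"
    using awalk_verts_conv' cas by simp
  then have "distinct (tl (pawalk_verts x ?p))"
    using assms by (auto simp: S.is_cycle_def xs)
  ultimately have "cycle ?p" unfolding cycle_def by force
  then show ?thesis using xs by (intro exI[of _ ?p]) simp
qed

text \<open>The label is preserved along reachability, hence constant on components. Choosing a
  representative of each component therefore reaches every label.\<close>

lemma num_labels_le_num_components:
  assumes f: "\<And>x y. x \<in> pverts G - S \<Longrightarrow> y \<in> pverts G - S \<Longrightarrow> (x, y) \<in> parcs G \<Longrightarrow> f x = f y"
  shows "card (f ` (pverts G - S)) \<le> num_components (delete_verts G S)"
proof -
  let ?D = "delete_verts G S"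
  have "subgraph ?D G"
    unfolding delete_verts_def by (rule induced_imp_subgraph, rule induced_induce) simp
  then interpret D: fin_digraph ?D by (rule fin_digraph_subgraph)
  have verts: "verts ?D = pverts G - S" by (simp add: delete_verts_def)
  have same: "f u = f v" if "u \<rightarrow>\<^sup>*\<^bsub>?D\<^esub> v" for u v
    using that
  proof (induction rule: D.reachable_induct)
    case (step v w)
    then have "v \<in> verts ?D" "w \<in> verts ?D" by (auto dest: D.adj_in_verts)
    moreover have "(v, w) \<in> parcs G"
      using dominates_induce_subgraphD[OF step.hyps(2)[unfolded delete_verts_def]] by simp
    ultimately show ?case using f step.IH verts by metis
  qed simp
  have "f ` (pverts G - S) \<subseteq> (\<lambda>C. f (SOME v. v \<in> C)) ` D.sccs_verts"
  proof
    fix l assume "l \<in> f ` (pverts G - S)"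
    then obtain u where u: "u \<in> verts ?D" "l = f u" using verts by auto
    have "u \<in> D.scc_of u" using D.in_scc_of_self u(1) .
    then have "(SOME v. v \<in> D.scc_of u) \<in> D.scc_of u" by (rule someI)
    then have "f u = f (SOME v. v \<in> D.scc_of u)" by (intro same) (simp add: D.scc_of_def)
    then show "l \<in> (\<lambda>C. f (SOME v. v \<in> C)) ` D.sccs_verts"
      using D.scc_of_in_sccs_verts[OF u(1)] u(2) by blast
  qed
  then have "card (f ` (pverts G - S)) \<le> card D.sccs_verts"
    by (rule surj_card_le[OF D.finite_sccs_verts])
  then show ?thesis by (simp add: num_components_def D.card_sccs_verts)
qed

lemma label_tough_if_tough:
  assumes "tough (real t) G"
  shows "label_tough t (pverts G) (parcs G)"
  unfolding label_tough_def
proof (intro allI impI)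
  fix S and f :: "'a \<Rightarrow> 'a"
  assume S: "S \<subseteq> pverts G"
    and f: "\<forall>x\<in>pverts G - S. \<forall>y\<in>pverts G - S. (x, y) \<in> parcs G \<longrightarrow> f x = f y"
    and two: "2 \<le> card (f ` (pverts G - S))"
  have le: "card (f ` (pverts G - S)) \<le> num_components (delete_verts G S)"
    using f by (intro num_labels_le_num_components) auto
  then have "vertex_cutset G S" using S two by (simp add: vertex_cutset_def)
  then have "real t * real (num_components (delete_verts G S)) \<le> real (card S)"
    using assms by (simp add: tough_def)
  then have "t * num_components (delete_verts G S) \<le> card S"
    by (simp only: of_nat_mult[symmetric] of_nat_le_iff)
  moreover have "t * card (f ` (pverts G - S)) \<le> t * num_components (delete_verts G S)"
    using le by (rule mult_le_mono2)
  ultimately show "t * card (f ` (pverts G - S)) \<le> card S" by linarith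
qed

end

theorem theorem2p1:
  fixes G :: "'a pair_pre_digraph" and t n m :: nat
  assumes "t \<in> {1, 2, 3}"
    and "pair_graph G"
    and "Digraph_Component.connected (with_proj G)"
    and "tough (real t) G"
    and "n = graph_order G"
    and "m = graph_size G"
    and "m \<ge> ((n - 2 * t) choose 2) + 3 * t ^ 2"
    and "(t = 1 \<and> n \<ge> 7) \<or> (t = 2 \<and> n \<ge> 16) \<or> (t = 3 \<and> n \<ge> 28)"
  shows "pancyclic G \<or> bipartite G"
proof -
  interpret pair_graph G by fact
  interpret S: sgraph "pverts G" "parcs G" by (rule sgraph)
  have n: "card (pverts G) = n" using assms(5) by (simp add: graph_order_def)
  have E: "card (parcs G) = 2 * m" using S.card_edges assms(6) by (simp add: graph_size_def)
  \<comment> \<open>Writing \<open>n\<close> as \<open>k + 2 * t + 1\<close> removes truncated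
    subtraction and turns twice the binomial into \<open>(k + 1) * k\<close>.\<close>
  define k where "k = n - 2 * t - 1"
  have nk: "n = k + 2 * t + 1" using assms(8) by (auto simp: k_def)
  have m2: "(k + 1) * k + 6 * t ^ 2 \<le> 2 * m"
  proof -
    have "2 * (Suc k choose 2) = (k + 1) * k"
      by (simp add: choose_two)
    moreover have "n - 2 * t = Suc k" using nk by simp
    ultimately show ?thesis using assms(7) by simp
  qed
  have "(\<Sum>v\<in>pverts G. S.codeg v) + 2 * m + n = n * n" using S.sum_codeg E n by simp
  \<comment> \<open>The bound \<open>4 * t * n - 10 * t ^ 2 - 2 * t\<close> is
    \<open>n * (n - 1)\<close> minus twice the assumed lower bound on \<open>m\<close>.\<close>
  then have "(\<Sum>v\<in>pverts G. S.codeg v) + 10 * t ^ 2 + 2 * t \<le> 4 * t * card (pverts G)"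
    using m2 unfolding n nk by (simp add: algebra_simps power2_eq_square)
  then have ham: S.hamiltonian
    using S.hamiltonian_if_tough_dense[OF label_tough_if_tough[OF assms(4)]] assms(8) n by simp
  have "n ^ 2 < 2 * (2 * m)"
  proof -
    have "4 \<le> k \<and> t = 1 \<or> 11 \<le> k \<and> t = 2 \<or> 21 \<le> k \<and> t = 3"
      using assms(8) nk by auto
    \<comment> \<open>After this substitution the lower bound for \<open>4 * m\<close> minus
      \<open>n ^ 2\<close> is a polynomial in \<open>j\<close> with positive coefficients.\<close>
    then obtain j where "k = 4 + j \<and> t = 1 \<or> k = 11 + j \<and> t = 2 \<or> k = 21 + j \<and> t = 3"
      by (meson le_Suc_ex)
    then show ?thesis
      using m2 unfolding nk by (elim disjE conjE) (simp_all add: algebra_simps power2_eq_square)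
  qed
  then have "\<exists>xs. S.is_cycle xs \<and> length xs = l" if "3 \<le> l" "l \<le> n" for l
    using S.hamiltonian_imp_all_cycles[OF ham] that E n by simp
  then have "pancyclic G"
    unfolding pancyclic_def using cycle_if_is_cycle n by (metis graph_order_def)
  then show ?thesis ..
qed

end
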